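(* For every $0<\epsilon\le1$ there exists a non-clairvoyant online algorithm which, given $1+\epsilon$ resource augmentation, is $O(1/\epsilon^3)$-competitive for minimizing total weighted flow time plus energy in the standard single-processor speed scaling model, for an arbitrary power function $P$ satisfying the standing assumptions below.
   Context: Standard speed scaling model: jobs $j$ arrive online at release times $r_j$, each with a weight $w_j>0$ and a processing volume $v_j$; the processor runs at a time-varying speed $s(t)$, completing work at rate $s(t)$ and consuming power $P(s(t))$; preemption is allowed. A job completes at time $C_j$ once $v_j$ units of work have been devoted to it. The objective is $\sum_j w_j(C_j-r_j)+\int_0^\infty P(s(t))\,dt$. An algorithm is non-clairvoyant if it is online and does not know the processing volume of a job (until it completes). The power function $P$ is arbitrary subject to: $P$ is defined, continuous and differentiable at all speeds, $P(0)=0$, $P$ is strictly increasing, strictly convex and unbounded. Resource augmentation: with $1+\epsilon$ resource augmentation the algorithm pays power $P(\gamma)$ when running at speed $(1+\epsilon)\gamma$. It is $c$-competitive if on every instance its objective is at most $c$ times the optimal offline objective (without augmentation). *)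

theory Defs
  imports "HOL-Analysis.Analysis"
begin

section \<open>Power functions\<close>

text \<open>Speeds are the nonnegative reals; values of the power function at negative arguments are
  irrelevant. Differentiability at speed 0 is one-sided.\<close>

definition strictly_convex_on :: "real set \<Rightarrow> (real \<Rightarrow> real) \<Rightarrow> bool" where
  "strictly_convex_on S f \<longleftrightarrow> convex S \<and>
     (\<forall>x\<in>S. \<forall>y\<in>S. \<forall>u. x \<noteq> y \<longrightarrow> 0 < u \<longrightarrow> u < 1 \<longrightarrow>
        f (u * x + (1 - u) * y) < u * f x + (1 - u) * f y)"

definition power_function :: "(real \<Rightarrow> real) \<Rightarrow> bool" where
  "power_function P \<longleftrightarrow>
     continuous_on {0..} P \<and> P differentiable_on {0..} \<and> P 0 = 0 \<and>
     strict_mono_on {0..} P \<and> strictly_convex_on {0..} P \<and> \<not> bdd_above (P ` {0..})"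

section \<open>Instances and schedules\<close>

record job_instance =
  jobs :: "nat set"
  release :: "nat \<Rightarrow> real"
  weight :: "nat \<Rightarrow> real"
  volume :: "nat \<Rightarrow> real"

definition valid_instance :: "job_instance \<Rightarrow> bool" where
  "valid_instance I \<longleftrightarrow> finite (jobs I) \<and>
     (\<forall>j\<in>jobs I. 0 \<le> release I j \<and> 0 < weight I j \<and> 0 \<le> volume I j)"

text \<open>A schedule \<open>x\<close> gives for every time \<open>t\<close> and job \<open>j\<close> the rate \<open>x t j\<close> at which \<open>j\<close> is processed
  at \<open>t\<close>. The processor may be time-shared, so several rates can be positive simultaneously;
  the speed of the processor is their sum.\<close>

type_synonym schedule = "real \<Rightarrow> nat \<Rightarrow> real"

definition speed :: "job_instance \<Rightarrow> schedule \<Rightarrow> real \<Rightarrow> real" where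
  "speed I x t = (\<Sum>j\<in>jobs I. x t j)"

text \<open>Local integrability of the rates loses no schedule of finite energy, since a power function
  grows at least linearly.\<close>

definition feasible :: "job_instance \<Rightarrow> schedule \<Rightarrow> bool" where
  "feasible I x \<longleftrightarrow>
     (\<forall>t j. 0 \<le> x t j) \<and>
     (\<forall>t j. j \<notin> jobs I \<or> t < release I j \<longrightarrow> x t j = 0) \<and>
     (\<forall>j T. set_integrable lborel {0..T} (\<lambda>t. x t j))"

definition work :: "schedule \<Rightarrow> nat \<Rightarrow> real \<Rightarrow> real" where
  "work x j t = (LBINT \<tau>:{0..t}. x \<tau> j)"

text \<open>A job that is never finished has completion time \<open>\<infinity>\<close> (the infimum of the empty set).\<close>

definition completion_time :: "job_instance \<Rightarrow> schedule \<Rightarrow> nat \<Rightarrow> ennreal" where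
  "completion_time I x j =
     Inf {ennreal t | t. release I j \<le> t \<and> volume I j \<le> work x j t}"

definition weighted_flow :: "job_instance \<Rightarrow> schedule \<Rightarrow> ennreal" where
  "weighted_flow I x =
     (\<Sum>j\<in>jobs I. ennreal (weight I j) * (completion_time I x j - ennreal (release I j)))"

text \<open>With augmentation factor \<open>\<sigma>\<close>, running at speed \<open>\<sigma> * \<gamma>\<close> costs power \<open>P \<gamma>\<close>;
  \<open>\<sigma> = 1\<close> means no augmentation.\<close>

definition energy :: "real \<Rightarrow> (real \<Rightarrow> real) \<Rightarrow> job_instance \<Rightarrow> schedule \<Rightarrow> ennreal" where
  "energy \<sigma> P I x = (\<integral>\<^sup>+t\<in>{0..}. ennreal (P (speed I x t / \<sigma>)) \<partial>lborel)"

definition cost :: "real \<Rightarrow> (real \<Rightarrow> real) \<Rightarrow> job_instance \<Rightarrow> schedule \<Rightarrow> ennreal" where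
  "cost \<sigma> P I x = weighted_flow I x + energy \<sigma> P I x"

definition opt_cost :: "(real \<Rightarrow> real) \<Rightarrow> job_instance \<Rightarrow> ennreal" where
  "opt_cost P I = (INF x\<in>{x. feasible I x}. cost 1 P I x)"

section \<open>Non-clairvoyant online algorithms\<close>

text \<open>What a non-clairvoyant scheduler has observed at time \<open>t\<close>: the current time and, for each job
  released so far, its release time, its weight, and its completion time if it has already
  completed. Volumes do not occur. The scheduler's own past decisions are determined by past
  observations, which can be recovered from the current one, and hence are not recorded.\<close>

type_synonym history = "real \<times> (nat \<Rightarrow> (real \<times> real \<times> ennreal option) option)"

definition history_at :: "job_instance \<Rightarrow> schedule \<Rightarrow> real \<Rightarrow> history" where
  "history_at I x t = (t, \<lambda>j.
     if j \<in> jobs I \<and> release I j \<le> t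
     then Some (release I j, weight I j,
       if completion_time I x j \<le> ennreal t then Some (completion_time I x j) else None)
     else None)"

type_synonym nonclairvoyant_algorithm = "history \<Rightarrow> nat \<Rightarrow> real"

text \<open>A schedule produced by an algorithm occurs on both sides of the defining equation, as its
  past determines the completions observed. Therefore \<open>competitive\<close> demands both that the
  algorithm can be run on every instance and that the bound holds for every resulting schedule.\<close>

definition runs :: "nonclairvoyant_algorithm \<Rightarrow> job_instance \<Rightarrow> schedule \<Rightarrow> bool" where
  "runs A I x \<longleftrightarrow> feasible I x \<and> (\<forall>t\<ge>0. x t = A (history_at I x t))"

definition competitive ::
  "real \<Rightarrow> (real \<Rightarrow> real) \<Rightarrow> real \<Rightarrow> nonclairvoyant_algorithm \<Rightarrow> bool" where
  "competitive \<sigma> P c A \<longleftrightarrow> (\<forall>I. valid_instance I \<longrightarrow>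
     (\<exists>x. runs A I x) \<and>
     (\<forall>x. runs A I x \<longrightarrow> cost \<sigma> P I x \<le> ennreal c * opt_cost P I))"

end

theory Submission
  imports Defs
begin

text \<open>The algorithm is weighted latest arrival processor sharing: if the unfinished jobs have total
  weight \<open>W\<close>, spend power \<open>W\<close> and share the processor among the most recently released jobs of
  total weight \<open>\<beta> W\<close>, \<open>\<beta> = \<epsilon> / 4\<close>. The potential is \<open>\<Sum>\<^sub>j g(W\<^sub>j) * max 0 D\<^sub>j\<close>, where
  \<open>g y = y / P\<^sup>-\<^sup>1 y\<close>, \<open>W\<^sub>j\<close> is the unfinished weight released no later than job \<open>j\<close>, and \<open>D\<^sub>j\<close> is the
  work by which the algorithm lags behind a competing schedule on \<open>j\<close>.
  By convexity the competitor, at speed \<open>s\<close>, increases it at rate at most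
  \<open>g W * s \<le> max W (P s)\<close>; the algorithm decreases it at rate at least
  \<open>(1 - \<beta>) (1 + \<epsilon>) (W - V / \<beta>)\<close>, where \<open>V\<close> is the competitor's unfinished weight, since a late job
  on which the algorithm does not lag is unfinished for the competitor as well.
  As \<open>(1 - \<beta>) (1 + \<epsilon>) \<ge> 1 + \<epsilon> / 2\<close>, this even gives a bound \<open>O(1 / \<epsilon>\<^sup>2)\<close>.
  Instead of differentiating the potential, one integrates for each job: the truncated change of
  \<open>D\<^sub>j\<close> has a nonnegative primitive, and stays nonnegative after weighting by the nonincreasing
  \<open>g(W\<^sub>j)\<close>, by the second mean value theorem.\<close>

section \<open>Integration\<close>

lemma integrable_on_if_measurable_condition:
  fixes g D :: "real \<Rightarrow> real"
  assumes g: "set_integrable lborel {0..T} g" and D: "continuous_on {0..T} D"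
  shows "(\<lambda>t. if 0 < D t then g t else 0) integrable_on {0..T}"
proof -
  have [measurable]: "(\<lambda>t. indicator {0..T} t *\<^sub>R D t) \<in> borel_measurable borel"
    by (rule borel_measurable_continuous_on_indicator) (use D in auto)
  have [measurable]: "(\<lambda>t. indicator {0..T} t *\<^sub>R g t) \<in> borel_measurable borel"
    using g unfolding set_integrable_def by (auto dest: borel_measurable_integrable)
  \<comment> \<open>Outside the interval the condition becomes \<open>0 < 0\<close>, so the
    indicator may be moved inside and only the functions extended by \<open>0\<close> have to be
    measurable.\<close>
  have eq: "(\<lambda>t. indicator {0..T} t *\<^sub>R (if 0 < D t then g t else 0)) =
     (\<lambda>t. if 0 < indicator {0..T} t *\<^sub>R D t then indicator {0..T} t *\<^sub>R g t else 0)"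
    by (auto simp: fun_eq_iff indicator_def)
  have "set_integrable lborel {0..T} (\<lambda>t. if 0 < D t then g t else 0)"
    by (rule set_integrable_bound[OF g]) (auto simp: set_borel_measurable_def eq simp del: real_scaleR_def)
  then show ?thesis
    by (rule set_borel_integral_eq_integral)
qed

text \<open>After the last time at which the difference of the two primitives is nonnegative, the
  truncated integrand vanishes.\<close>

lemma integral_ge_integral_restricted_to_excess:
  fixes f g :: "real \<Rightarrow> real"
  defines "D \<equiv> \<lambda>t. integral {0..t} f - integral {0..t} g"
  assumes f: "set_integrable lborel {0..T} f" and g: "set_integrable lborel {0..T} g"
    and nonneg: "\<And>t. 0 \<le> f t" "\<And>t. 0 \<le> g t" and "0 \<le> T"
  shows "integral {0..T} (\<lambda>t. if 0 < D t then g t else 0) \<le> integral {0..T} f"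
proof -
  let ?h = "\<lambda>t. if 0 < D t then g t else 0"
  have fi: "f integrable_on {0..T}" and gi: "g integrable_on {0..T}"
    using f g by (auto intro: set_borel_integral_eq_integral)
  have cont: "continuous_on {0..T} D"
    unfolding D_def using fi gi by (intro continuous_on_diff indefinite_integral_continuous_1)
  have hi: "?h integrable_on {0..T}"
    by (rule integrable_on_if_measurable_condition[OF g cont])
  \<comment> \<open>The weak inequality makes \<open>Z\<close> closed, and \<open>0 \<in> Z\<close>
    since both primitives vanish at \<open>0\<close>; hence a last such time \<open>v\<close> is
    attained.\<close>
  define Z where "Z = {t \<in> {0..T}. 0 \<le> D t}"
  have "closed (D -` {0..} \<inter> {0..T})"
    using cont by (auto simp: continuous_on_closed_vimage)
  then have "compact Z"
    unfolding Z_def compact_eq_bounded_closed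
    by (auto simp: Int_def vimage_def conj_commute intro: bounded_subset[of "{0..T}"])
  moreover have "0 \<in> Z" using \<open>0 \<le> T\<close> by (auto simp: Z_def D_def)
  ultimately obtain v where v: "v \<in> Z" and vmax: "\<And>t. t \<in> Z \<Longrightarrow> t \<le> v"
    using compact_attains_sup[of Z] by auto
  have v0: "0 \<le> v" "v \<le> T" "0 \<le> D v" using v by (auto simp: Z_def)
  have *: "integral {0..v} k + integral {v..T} k = integral {0..T} k"
    if "k integrable_on {0..T}" for k :: "real \<Rightarrow> real"
    using v0 that by (intro Henstock_Kurzweil_Integration.integral_combine) auto
  have "integral {v..T} ?h = integral {v..T} (\<lambda>_. 0)"
  proof (rule integral_spike[where S = "{v}"])
    fix t assume t: "t \<in> {v..T} - {v}"
    then have "t \<notin> Z" using vmax by force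
    then show "0 = ?h t" using t v0 by (auto simp: Z_def)
  qed auto
  then have "integral {0..T} ?h = integral {0..v} ?h" using *[OF hi] by simp
  also have "\<dots> \<le> integral {0..v} g"
    using v0 nonneg by (intro integral_le integrable_on_subinterval[OF hi]
        integrable_on_subinterval[OF gi]) auto
  also have "\<dots> \<le> integral {0..v} f" using v0 by (simp add: D_def)
  also have "\<dots> \<le> integral {0..T} f"
    using v0 nonneg by (intro integral_subset_le fi integrable_on_subinterval[OF fi]) auto
  finally show ?thesis .
qed

text \<open>The second mean value theorem reduces \<open>c\<close> to its two end values. With
  \<open>H\<close> the primitive of \<open>h\<close>, the integral is
  \<open>(c 0 - c T) * H u + c T * H T\<close>, where all factors are nonnegative.\<close>

lemma integral_antimono_weight_nonneg:
  fixes h c :: "real \<Rightarrow> real"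
  assumes h: "h integrable_on {0..T}" and "0 \<le> T"
    and prim: "\<And>u. 0 \<le> u \<Longrightarrow> u \<le> T \<Longrightarrow> 0 \<le> integral {0..u} h"
    and anti: "\<And>s t. 0 \<le> s \<Longrightarrow> s \<le> t \<Longrightarrow> t \<le> T \<Longrightarrow> c t \<le> c s"
    and c: "\<And>t. 0 \<le> t \<Longrightarrow> t \<le> T \<Longrightarrow> 0 \<le> c t"
  shows "(\<lambda>t. c t * h t) integrable_on {0..T}" "0 \<le> integral {0..T} (\<lambda>t. c t * h t)"
proof -
  \<comment> \<open>The theorem is applied to \<open>- c\<close>, which is nondecreasing.\<close>
  obtain u where u: "u \<in> {0..T}"
    and "((\<lambda>t. - c t * h t) has_integral
          - c 0 * integral {0..u} h + - c T * integral {u..T} h) {0..T}"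
    using second_mean_value_theorem_full[OF h \<open>0 \<le> T\<close>, of "\<lambda>t. - c t"] anti by force
  from has_integral_neg[OF this(2)]
  have int: "((\<lambda>t. c t * h t) has_integral
      c 0 * integral {0..u} h + c T * integral {u..T} h) {0..T}" by (simp add: add.commute)
  have e: "integral {0..u} h + integral {u..T} h = integral {0..T} h"
    using u h by (intro Henstock_Kurzweil_Integration.integral_combine) auto
  then have "c 0 * integral {0..u} h + c T * integral {u..T} h =
      (c 0 - c T) * integral {0..u} h + c T * integral {0..T} h"
    by (simp add: algebra_simps flip: e)
  also have "\<dots> \<ge> 0"
    using u prim[of u] prim[of T] anti[of 0 T] c[of T] \<open>0 \<le> T\<close>
    by (intro add_nonneg_nonneg mult_nonneg_nonneg) auto
  finally show "(\<lambda>t. c t * h t) integrable_on {0..T}" "0 \<le> integral {0..T} (\<lambda>t. c t * h t)"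
    using int by (auto simp: has_integral_iff)
qed

section \<open>Power functions and prices\<close>

locale power_fun =
  fixes P :: "real \<Rightarrow> real"
  assumes power_function: "power_function P"
begin

lemma P_zero: "P 0 = 0"
  using power_function by (simp add: power_function_def)

lemma P_strict_mono: "0 \<le> x \<Longrightarrow> x < y \<Longrightarrow> P x < P y"
  using power_function by (auto simp: power_function_def strict_mono_on_def)

lemma P_mono: "0 \<le> x \<Longrightarrow> x \<le> y \<Longrightarrow> P x \<le> P y"
  using P_strict_mono[of x y] by (cases "x = y") auto

lemma P_nonneg: "0 \<le> x \<Longrightarrow> 0 \<le> P x"
  using P_mono[of 0 x] P_zero by simp

text \<open>Convexity between \<open>s\<close> and \<open>0\<close>, together with
  \<open>P 0 = 0\<close>; the degenerate cases, where equality holds, are not covered by strict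
  convexity.\<close>

lemma P_star_shaped: 
  assumes "0 \<le> u" "u \<le> 1" "0 \<le> s"
  shows "P (u * s) \<le> u * P s"
proof (cases "s = 0 \<or> u = 0 \<or> u = 1")
  case False
  moreover have "\<forall>x\<in>{0..}. \<forall>y\<in>{0..}. \<forall>u. x \<noteq> y \<longrightarrow> 0 < u \<longrightarrow> u < 1 \<longrightarrow>
      P (u * x + (1 - u) * y) < u * P x + (1 - u) * P y"
    using power_function by (simp add: power_function_def strictly_convex_on_def)
  from this[rule_format, of s 0 u] have "s \<noteq> 0 \<Longrightarrow> 0 < u \<Longrightarrow> u < 1 \<Longrightarrow> P (u * s) < u * P s"
    using assms P_zero by simp
  ultimately show ?thesis using assms by simp
qed (auto simp: P_zero)

text \<open>Values of \<open>P\<close> at negative arguments are arbitrary; composing with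
  \<open>max 0\<close> gives a function continuous on the whole line.\<close>

lemma P_measurable: "(\<lambda>t. P (max 0 t)) \<in> borel_measurable borel"
proof (rule borel_measurable_continuous_onI)
  have "continuous_on {0..} P" using power_function by (simp add: power_function_def)
  then show "continuous_on UNIV (\<lambda>t. P (max 0 t))"
    by (rule continuous_on_compose2) (auto intro!: continuous_intros)
qed

definition pinv :: "real \<Rightarrow> real" where
  "pinv y = inv_into {0..} P y"

text \<open>Unboundedness and the intermediate value theorem put every nonnegative \<open>y\<close>
  into the range of \<open>P\<close> on nonnegative speeds.\<close>

lemma P_pinv: "0 \<le> y \<Longrightarrow> P (pinv y) = y" and pinv_nonneg: "0 \<le> y \<Longrightarrow> 0 \<le> pinv y"
proof -
  assume y: "0 \<le> y"
  have "\<not> bdd_above (P ` {0..})" using power_function by (simp add: power_function_def)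
  then obtain s where s: "0 \<le> s" "y < P s"
    by (force simp: bdd_above_def not_le)
  have "continuous_on {0..s} P"
    using power_function by (auto simp: power_function_def intro: continuous_on_subset)
  then obtain x where "0 \<le> x" "P x = y"
    using IVT'[of P 0 y s] s y P_zero by auto
  then have "y \<in> P ` {0..}" by auto
  from f_inv_into_f[OF this] inv_into_into[OF this] show "P (pinv y) = y" "0 \<le> pinv y"
    by (auto simp: pinv_def)
qed

lemma pinv_mono: "0 \<le> x \<Longrightarrow> x \<le> y \<Longrightarrow> pinv x \<le> pinv y"
  by (rule ccontr) (use P_strict_mono[of "pinv y" "pinv x"] in \<open>simp add: P_pinv pinv_nonneg\<close>)

lemma pinv_pos: "0 < y \<Longrightarrow> 0 < pinv y"
  using P_pinv[of y] P_zero pinv_nonneg[of y] by (cases "pinv y = 0") auto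

text \<open>The price of one unit of work in the potential; it is \<open>0\<close> at weight \<open>0\<close>.\<close>

definition price :: "real \<Rightarrow> real" where
  "price y = y / pinv y"

lemma price_nonneg: "0 \<le> y \<Longrightarrow> 0 \<le> price y"
  by (simp add: price_def pinv_nonneg)

text \<open>Star-shapedness with ratio \<open>s / t\<close>. The quotient is the energy per unit of
  work, and for \<open>0 < y\<close> it equals \<open>price y\<close> at speed
  \<open>pinv y\<close>, so prices inherit the monotonicity.\<close>

lemma power_quotient_mono:
  assumes "0 < s" "s \<le> t" shows "P s / s \<le> P t / t"
  using P_star_shaped[of "s / t" t] assms by (simp add: field_simps)

lemma price_mono:
  assumes "0 \<le> x" "x \<le> y" shows "price x \<le> price y"
proof (cases "x = 0")
  case True
  then show ?thesis using price_nonneg[of y] assms by (simp add: price_def)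
next
  case False
  then show ?thesis
    using power_quotient_mono[of "pinv x" "pinv y"] assms pinv_pos[of x] pinv_mono[of x y]
    by (simp add: price_def P_pinv)
qed

text \<open>At speeds up to \<open>pinv y\<close> the product is at most \<open>y\<close>. At higher
  speeds the price is at most the energy per unit of work \<open>P s / s\<close>, so the product is
  at most \<open>P s\<close>.\<close>

lemma price_mult_speed_le:
  assumes "0 \<le> y" "0 \<le> s" shows "price y * s \<le> y + P s"
proof (cases "s \<le> pinv y")
  case True
  then have "price y * s \<le> price y * pinv y"
    by (simp add: assms mult_left_mono price_nonneg)
  also have "\<dots> \<le> y" using assms by (simp add: price_def)
  finally show ?thesis using P_nonneg[OF assms(2)] by simp
next
  case False
  show ?thesis
  proof (cases "y = 0")
    case True then show ?thesis using P_nonneg[OF assms(2)] by (simp add: price_def)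
  next
    case y: False
    then have "price y \<le> P s / s"
      using power_quotient_mono[of "pinv y" s] False assms pinv_pos[of y]
      by (simp add: price_def P_pinv)
    then have "price y * s \<le> P s" using False y assms pinv_pos[of y]
      by (simp add: field_simps)
    then show ?thesis using assms by simp
  qed
qed

text \<open>Meant for \<open>x\<close> the weight up to some job and \<open>y\<close> the total
  weight: the price depends on the former, the speed of the algorithm on the latter, and the larger
  speed only helps.\<close>

lemma price_mult_pinv_ge:
  assumes "0 < x" "x \<le> y" shows "x \<le> price x * pinv y"
proof -
  have "x = price x * pinv x" using pinv_pos[OF assms(1)] by (simp add: price_def)
  also have "\<dots> \<le> price x * pinv y"
    using assms by (intro mult_left_mono pinv_mono price_nonneg) auto
  finally show ?thesis .
qed

end

section \<open>Active jobs and runs\<close>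

lemma work_eq_integral:
  assumes "feasible I x"
  shows "(\<lambda>\<tau>. x \<tau> j) integrable_on {0..t}" "work x j t = integral {0..t} (\<lambda>\<tau>. x \<tau> j)"
  using assms by (auto simp: feasible_def work_def intro: set_borel_integral_eq_integral)

lemma feasible_nonneg: "feasible I x \<Longrightarrow> 0 \<le> x t j"
  by (simp add: feasible_def)

lemma work_mono:
  assumes "feasible I x" "s \<le> t" shows "work x j s \<le> work x j t"
  unfolding work_eq_integral(2)[OF assms(1)]
  using assms work_eq_integral(1) feasible_nonneg by (intro integral_subset_le) auto

lemma work_continuous:
  assumes "feasible I x" shows "continuous_on {0..T} (work x j)"
  unfolding work_eq_integral(2)[OF assms, abs_def]
  by (rule indefinite_integral_continuous_1) (rule work_eq_integral(1)[OF assms])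

lemma release_le_completion_time: "ennreal (release I j) \<le> completion_time I x j"
  unfolding completion_time_def by (auto intro!: Inf_greatest ennreal_leI)

text \<open>The infimum is attained because work is continuous: if the volume is not reached at
  \<open>t\<close>, it is not reached shortly after \<open>t\<close> either, and by monotonicity not
  before.\<close>

lemma completion_time_le_iff:
  assumes I: "valid_instance I" and x: "feasible I x" and j: "j \<in> jobs I" and t: "0 \<le> t"
  shows "completion_time I x j \<le> ennreal t \<longleftrightarrow> release I j \<le> t \<and> volume I j \<le> work x j t"
proof
  assume "release I j \<le> t \<and> volume I j \<le> work x j t"
  then show "completion_time I x j \<le> ennreal t"
    unfolding completion_time_def by (intro Inf_lower) auto
next
  assume le: "completion_time I x j \<le> ennreal t"
  have r: "release I j \<le> t"
    using order_trans[OF release_le_completion_time le] t by (simp add: ennreal_le_iff)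
  have "volume I j \<le> work x j t"
  proof (rule ccontr)
    assume "\<not> ?thesis"
    moreover have "continuous (at t within {0..t+1}) (work x j)"
      using work_continuous[OF x, of "t+1" j] t by (auto simp: continuous_on_eq_continuous_within)
    ultimately have "eventually (\<lambda>s. work x j s < volume I j) (at t within {0..t+1})"
      by (auto simp: continuous_within intro: order_tendstoD)
    then obtain d where "d > 0" and d: "\<And>s. s \<in> {0..t+1} \<Longrightarrow> s \<noteq> t \<Longrightarrow> dist s t < d \<Longrightarrow>
        work x j s < volume I j"
      unfolding eventually_at by auto
    \<comment> \<open>Half of \<open>d\<close> keeps \<open>u\<close> strictly inside the
      neighbourhood, and the cap \<open>1\<close> keeps it in \<open>{0..t+1}\<close>.\<close>
    define u where "u = t + min (d/2) 1"
    have u: "t < u" using \<open>d > 0\<close> by (simp add: u_def)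
    have wu: "work x j u < volume I j"
      using \<open>d > 0\<close> t by (intro d) (auto simp: u_def dist_real_def)
    have "ennreal u \<le> completion_time I x j"
      unfolding completion_time_def
    proof (rule Inf_greatest, safe)
      fix s assume "volume I j \<le> work x j s"
      then have "\<not> s \<le> u" using wu work_mono[OF x, of s u j] by auto
      then show "ennreal u \<le> ennreal s" by (intro ennreal_leI) auto
    qed
    also have "\<dots> \<le> ennreal t" by fact
    finally show False using u t by (simp add: ennreal_le_iff)
  qed
  with r show "release I j \<le> t \<and> volume I j \<le> work x j t" ..
qed

text \<open>A job is no longer active at its completion time itself, in agreement with
  \<open>history_at\<close>, which reports completions up to and including \<open>t\<close>.\<close>

definition active :: "job_instance \<Rightarrow> schedule \<Rightarrow> real \<Rightarrow> nat set" where
  "active I x t = {j \<in> jobs I. release I j \<le> t \<and> ennreal t < completion_time I x j}"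

lemma in_active_iff:
  assumes "valid_instance I" "feasible I x" "0 \<le> t"
  shows "j \<in> active I x t \<longleftrightarrow> j \<in> jobs I \<and> release I j \<le> t \<and> work x j t < volume I j"
  using completion_time_le_iff[OF assms(1,2) _ assms(3), of j]
  by (auto simp: active_def not_le[symmetric])

lemma finite_active: "valid_instance I \<Longrightarrow> finite (active I x t)"
  by (auto simp: valid_instance_def active_def)

definition active_weight :: "job_instance \<Rightarrow> schedule \<Rightarrow> real \<Rightarrow> real" where
  "active_weight I x t = sum (weight I) (active I x t)"

lemma active_weight_nonneg: "valid_instance I \<Longrightarrow> 0 \<le> active_weight I x t"
  unfolding active_weight_def active_def valid_instance_def
  by (intro sum_nonneg) (auto intro: less_imp_le)

section \<open>Weighted flow time as the integral of the active weight\<close>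

lemma active_weight_eq:
  assumes "valid_instance I"
  shows "active_weight I x t =
    (\<Sum>j\<in>jobs I. weight I j * indicator {t. release I j \<le> t \<and> ennreal t < completion_time I x j} t)"
  using assms unfolding active_weight_def active_def valid_instance_def indicator_def of_bool_def
  by (auto split: if_splits intro!: sum.mono_neutral_cong_left)

lemma borel_measurable_active_weight [measurable]:
  assumes "valid_instance I" shows "active_weight I x \<in> borel_measurable borel"
  unfolding active_weight_eq[OF assms, abs_def] by measurable

lemma flow_time_eq_nn_integral:
  assumes "valid_instance I" "j \<in> jobs I"
  shows "completion_time I x j - ennreal (release I j) = (\<integral>\<^sup>+t\<in>{0..}.
     indicator {t. release I j \<le> t \<and> ennreal t < completion_time I x j} t \<partial>lborel)"
proof -
  let ?A = "{t. release I j \<le> t \<and> ennreal t < completion_time I x j}"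
  have r: "0 \<le> release I j" using assms by (auto simp: valid_instance_def)
  have "(\<integral>\<^sup>+t\<in>{0..}. indicator ?A t \<partial>lborel) = (\<integral>\<^sup>+t. indicator ?A t \<partial>lborel)"
    using r by (intro nn_integral_cong) (auto simp: indicator_def)
  also have "\<dots> = emeasure lborel ?A" by (intro nn_integral_indicator) measurable
  also have "\<dots> = completion_time I x j - ennreal (release I j)"
  proof (cases "completion_time I x j")
    case (real c)
    then have c: "0 \<le> c" "release I j \<le> c"
      using release_le_completion_time[of I j x] r by (auto simp: ennreal_le_iff)
    have "?A = {release I j..<c}" using real c r by (auto simp: ennreal_less_iff)
    then show ?thesis using real c r by (simp add: ennreal_minus)
  next
    case top
    have "emeasure lborel {release I j..} = \<infinity>"
    proof (rule ccontr)
      assume "emeasure lborel {release I j..} \<noteq> \<infinity>"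
      then obtain k :: real where k: "0 \<le> k" "emeasure lborel {release I j..} = ennreal k"
        by (cases "emeasure lborel {release I j..}") auto
      have "emeasure lborel {release I j..release I j + k + 1} \<le> emeasure lborel {release I j..}"
        by (rule emeasure_mono) auto
      then show False using k by (simp add: ennreal_le_iff)
    qed
    moreover have "?A = {release I j..}" using top by auto
    ultimately show ?thesis using top by simp
  qed
  finally show ?thesis by simp
qed

text \<open>Each flow time is the measure of the set of times at which the job is active; sum and
  integral are then exchanged.\<close>

lemma weighted_flow_eq_nn_integral:
  assumes I: "valid_instance I"
  shows "weighted_flow I x = (\<integral>\<^sup>+t\<in>{0..}. ennreal (active_weight I x t) \<partial>lborel)"
proof -
  let ?A = "\<lambda>j. {t. release I j \<le> t \<and> ennreal t < completion_time I x j}"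
  have "weighted_flow I x = (\<Sum>j\<in>jobs I. \<integral>\<^sup>+t. ennreal (weight I j) *
      (indicator (?A j) t * indicator {0..} t) \<partial>lborel)"
    unfolding weighted_flow_def
    by (intro sum.cong refl) (simp add: nn_integral_cmult flow_time_eq_nn_integral[OF I])
  also have "\<dots> = (\<integral>\<^sup>+t. (\<Sum>j\<in>jobs I. ennreal (weight I j) *
      (indicator (?A j) t * indicator {0..} t)) \<partial>lborel)"
    by (rule nn_integral_sum[symmetric]) measurable
  also have "\<dots> = (\<integral>\<^sup>+t\<in>{0..}. ennreal (active_weight I x t) \<partial>lborel)"
  proof (rule nn_integral_cong)
    fix t
    have "ennreal (active_weight I x t) = (\<Sum>j\<in>jobs I. ennreal (weight I j * indicator (?A j) t))"
      unfolding active_weight_eq[OF I] using I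
      by (intro sum_ennreal[symmetric]) (auto simp: valid_instance_def less_imp_le)
    also have "\<dots> = (\<Sum>j\<in>jobs I. ennreal (weight I j) * indicator (?A j) t)"
      by (intro sum.cong refl) (auto simp: indicator_def)
    finally show "(\<Sum>j\<in>jobs I. ennreal (weight I j) * (indicator (?A j) t * indicator {0..} t)) =
        ennreal (active_weight I x t) * indicator {0..} t"
      by (simp add: sum_distrib_right mult.assoc)
  qed
  finally show ?thesis .
qed

section \<open>Existence of runs, built from event to event\<close>

definition switch :: "schedule \<Rightarrow> real \<Rightarrow> (nat \<Rightarrow> real) \<Rightarrow> schedule" where
  "switch x T \<rho> t = (if t < T then x t else \<rho>)"

lemma feasible_switch:
  assumes x: "feasible I x" and "\<And>j. 0 \<le> \<rho> j"
    and "\<And>j. \<rho> j \<noteq> 0 \<Longrightarrow> j \<in> jobs I \<and> release I j \<le> T"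
  shows "feasible I (switch x T \<rho>)"
proof -
  have "set_integrable lborel {0..U} (\<lambda>t. switch x T \<rho> t j)" for j U
  proof -
    have 1: "set_integrable lborel ({0..U} \<inter> {..<T}) (\<lambda>t. x t j)"
      using x by (intro set_integrable_subset[of _ "{0..U}" _ "{0..U} \<inter> {..<T}"])
        (auto simp: feasible_def)
    have 2: "set_integrable lborel ({0..U} \<inter> {T..}) (\<lambda>t. \<rho> j)"
      by (rule set_integrable_subset[of _ "{0..U}"])
        (auto simp: set_integrable_def emeasure_lborel_Icc_eq)
    have "set_integrable lborel (({0..U} \<inter> {..<T}) \<union> ({0..U} \<inter> {T..})) (\<lambda>t. switch x T \<rho> t j)"
    proof (rule set_integrable_Un)
      show "set_integrable lborel ({0..U} \<inter> {..<T}) (\<lambda>t. switch x T \<rho> t j)"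
        using 1 by (rule set_integrable_cong[THEN iffD1, rotated 3]) (auto simp: switch_def)
      show "set_integrable lborel ({0..U} \<inter> {T..}) (\<lambda>t. switch x T \<rho> t j)"
        using 2 by (rule set_integrable_cong[THEN iffD1, rotated 3]) (auto simp: switch_def)
    qed auto
    also have "({0..U} \<inter> {..<T}) \<union> ({0..U} \<inter> {T..}) = {0..U}" by auto
    finally show ?thesis .
  qed
  moreover have "switch x T \<rho> t j = 0" if "j \<notin> jobs I \<or> t < release I j" for t j
    using x assms(3)[of j] that by (force simp: switch_def feasible_def)
  ultimately show ?thesis using x assms(2) by (auto simp: feasible_def switch_def)
qed

lemma work_switch:
  assumes x: "feasible I x" and y: "feasible I (switch x T \<rho>)" and "0 \<le> T"
  shows "t \<le> T \<Longrightarrow> work (switch x T \<rho>) j t = work x j t"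
    and "T \<le> t \<Longrightarrow> work (switch x T \<rho>) j t = work x j T + \<rho> j * (t - T)"
proof -
  show 1: "work (switch x T \<rho>) j t = work x j t" if "t \<le> T" for t
    unfolding work_eq_integral(2)[OF x] work_eq_integral(2)[OF y]
    by (rule integral_spike[of "{T}"]) (use that in \<open>auto simp: switch_def\<close>)
  show "work (switch x T \<rho>) j t = work x j T + \<rho> j * (t - T)" if "T \<le> t"
  proof -
    have "work (switch x T \<rho>) j t = work (switch x T \<rho>) j T
        + integral {T..t} (\<lambda>\<tau>. switch x T \<rho> \<tau> j)"
      unfolding work_eq_integral(2)[OF y] using that assms
      by (intro Henstock_Kurzweil_Integration.integral_combine[symmetric] work_eq_integral(1)[OF y])
    also have "integral {T..t} (\<lambda>\<tau>. switch x T \<rho> \<tau> j) = integral {T..t} (\<lambda>_. \<rho> j)"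
      by (rule integral_cong) (auto simp: switch_def)
    finally show ?thesis using 1[of T] that by simp
  qed
qed

text \<open>The rule \<open>R\<close> sees only the active set, so rates change only at releases and
  completions. Feasibility is global, while the rule is imposed only on the times \<open>X\<close>
  already constructed.\<close>

definition follows ::
  "job_instance \<Rightarrow> (nat set \<Rightarrow> nat \<Rightarrow> real) \<Rightarrow> schedule \<Rightarrow> real set \<Rightarrow> bool" where
  "follows I R x X \<longleftrightarrow> feasible I x \<and> (\<forall>t\<in>X. x t = R (active I x t))"

text \<open>The rates prescribed at \<open>T\<close> are frozen until the next event. Without a
  further event they are right forever; otherwise the event removes a job from the unreleased or
  from the unfinished ones, which makes an induction possible.\<close>

lemma follows_extend:
  assumes I: "valid_instance I" and R: "\<forall>S j. 0 \<le> R S j" "\<forall>S j. j \<notin> S \<longrightarrow> R S j = 0"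
    and x: "follows I R x {0..<T}" and T: "0 \<le> T"
  shows "(\<exists>y. follows I R y {0..}) \<or> (\<exists>y T'. T \<le> T' \<and> follows I R y {0..<T'} \<and>
     {j \<in> jobs I. T' < release I j} \<subseteq> {j \<in> jobs I. T < release I j} \<and>
     {j \<in> jobs I. work y j T' < volume I j} \<subseteq> {j \<in> jobs I. work x j T < volume I j} \<and>
     ({j \<in> jobs I. T' < release I j} \<noteq> {j \<in> jobs I. T < release I j} \<or>
     {j \<in> jobs I. work y j T' < volume I j} \<noteq> {j \<in> jobs I. work x j T < volume I j}))"
proof -
  define S where "S = active I x T"
  define \<rho> where "\<rho> = R S"
  define y where "y = switch x T \<rho>"
  have fx: "feasible I x" using x by (simp add: follows_def)
  have inS: "j \<in> S \<longleftrightarrow> j \<in> jobs I \<and> release I j \<le> T \<and> work x j T < volume I j" for j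
    unfolding S_def by (rule in_active_iff[OF I fx T])
  have "j \<in> S" if "\<rho> j \<noteq> 0" for j
    using that R(2) by (auto simp: \<rho>_def)
  then have fy: "feasible I y"
    unfolding y_def using R(1) inS by (intro feasible_switch fx) (auto simp: \<rho>_def)
  note wk = work_switch[OF fx fy[unfolded y_def] T, folded y_def]
  have act: "active I y t = active I x t" if "0 \<le> t" "t \<le> T" for t
    using in_active_iff[OF I fx that(1)] in_active_iff[OF I fy that(1)] wk(1) that by auto
  \<comment> \<open>All candidate events after \<open>T\<close>: the outstanding releases, and the
    times at which active jobs would complete at their frozen rates.\<close>
  define F where "F = release I ` {j \<in> jobs I. T < release I j} \<union>
      (\<lambda>j. T + (volume I j - work x j T) / \<rho> j) ` {j \<in> S. 0 < \<rho> j}"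
  have fin: "finite F" using I finite_active[OF I] by (auto simp: F_def S_def valid_instance_def)
  have F: "T < e" if "e \<in> F" for e
    using that inS by (auto simp: F_def)
  have const: "active I y t = S" if t: "T \<le> t" "\<forall>e\<in>F. t < e" for t
  proof (rule set_eqI)
    fix j
    have iff: "j \<in> active I y t \<longleftrightarrow> j \<in> jobs I \<and> release I j \<le> t \<and> work y j t < volume I j"
      using T t by (intro in_active_iff[OF I fy]) auto
    have w: "work y j t = work x j T + \<rho> j * (t - T)" using wk(2) t by auto
    show "j \<in> active I y t \<longleftrightarrow> j \<in> S"
    proof
      assume "j \<in> S"
      have "work y j t < volume I j"
      proof (cases "0 < \<rho> j")
        case True
        then have "t < T + (volume I j - work x j T) / \<rho> j"
          using t(2) \<open>j \<in> S\<close> by (auto simp: F_def)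
        then show ?thesis using True w by (simp add: field_simps)
      next
        case False
        then have "\<rho> j = 0" using R(1) by (auto simp: \<rho>_def not_less intro: order_antisym)
        then show ?thesis using w \<open>j \<in> S\<close> inS by simp
      qed
      then show "j \<in> active I y t" using iff \<open>j \<in> S\<close> inS t by auto
    next
      assume "j \<in> active I y t"
      then have j: "j \<in> jobs I" "release I j \<le> t" "work y j t < volume I j" using iff by auto
      moreover have "work x j T \<le> work y j t"
        using w t R(1) by (simp add: \<rho>_def)
      moreover have "\<not> T < release I j"
      proof
        assume "T < release I j"
        then have "release I j \<in> F" using j(1) by (auto simp: F_def)
        then show False using t(2) j(2) by force
      qed
      ultimately show "j \<in> S" using inS by auto
    qed
  qed
  have follow: "y t = R (active I y t)" if "0 \<le> t" "\<forall>e\<in>F. t < e" for t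
  proof (cases "t < T")
    case True
    then have "y t = x t" by (simp add: y_def switch_def)
    also have "\<dots> = R (active I x t)" using x True that by (auto simp: follows_def)
    also have "active I x t = active I y t" using act True that by auto
    finally show ?thesis .
  next
    case False
    then have "y t = R S" by (simp add: y_def switch_def \<rho>_def)
    then show ?thesis using const False that by auto
  qed
  show ?thesis
  proof (cases "F = {}")
    case True
    then have "follows I R y {0..}" using fy follow by (auto simp: follows_def)
    then show ?thesis by blast
  next
    case False
    define T' where "T' = Min F"
    have T': "T' \<in> F" "\<And>e. e \<in> F \<Longrightarrow> T' \<le> e" using fin False by (auto simp: T'_def)
    have TT: "T < T'" using F T' by auto
    have "follows I R y {0..<T'}"
      using fy follow T' by (force simp: follows_def)
    moreover have "{j \<in> jobs I. T' < release I j} \<subseteq> {j \<in> jobs I. T < release I j}"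
      using TT by auto
    moreover have "work x j T \<le> work y j T'" for j
      using wk(2)[of T' j] TT R(1) by (simp add: \<rho>_def)
    then have "{j \<in> jobs I. work y j T' < volume I j} \<subseteq> {j \<in> jobs I. work x j T < volume I j}"
      using order_le_less_trans by blast
    moreover have "{j \<in> jobs I. T' < release I j} \<noteq> {j \<in> jobs I. T < release I j} \<or>
     {j \<in> jobs I. work y j T' < volume I j} \<noteq> {j \<in> jobs I. work x j T < volume I j}"
      using T'(1) unfolding F_def
    proof
      assume "T' \<in> release I ` {j \<in> jobs I. T < release I j}"
      then obtain j where "j \<in> jobs I" "T < release I j" "T' = release I j" by auto
      then have "j \<in> {j \<in> jobs I. T < release I j}" "j \<notin> {j \<in> jobs I. T' < release I j}" by auto
      then show ?thesis by metis
    next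
      assume "T' \<in> (\<lambda>j. T + (volume I j - work x j T) / \<rho> j) ` {j \<in> S. 0 < \<rho> j}"
      then obtain j where j: "j \<in> S" "0 < \<rho> j" "T' = T + (volume I j - work x j T) / \<rho> j" by auto
      then have "work y j T' = volume I j" using wk(2)[of T' j] TT by simp
      then have "j \<notin> {j \<in> jobs I. work y j T' < volume I j}"
        "j \<in> {j \<in> jobs I. work x j T < volume I j}" using j inS by auto
      then show ?thesis by metis
    qed
    ultimately show ?thesis using TT by (intro disjI2 exI[of _ y] exI[of _ T']) auto
  qed
qed

lemma exists_follows:
  assumes I: "valid_instance I" and R: "\<forall>S j. 0 \<le> R S j" "\<forall>S j. j \<notin> S \<longrightarrow> R S j = 0"
  shows "\<exists>x. follows I R x {0..}"
proof -
  have fin: "finite (jobs I)" using I by (simp add: valid_instance_def)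
  \<comment> \<open>Each event decreases the number of unreleased jobs plus the number of unfinished
    jobs. The induction starts from the idle schedule on the empty interval.\<close>
  have "\<exists>y. follows I R y {0..}" if "follows I R x {0..<T}" "0 \<le> T"
      "n = card {j \<in> jobs I. T < release I j} + card {j \<in> jobs I. work x j T < volume I j}"
    for n x T
    using that
  proof (induction n arbitrary: x T rule: less_induct)
    case (less n)
    from follows_extend[OF I R less.prems(1,2)] show ?case
    proof (elim disjE exE conjE, goal_cases)
      case (2 y T')
      have "card {j \<in> jobs I. T' < release I j} + card {j \<in> jobs I. work y j T' < volume I j} < n"
        unfolding less.prems(3)
        using 2(3-) fin by (auto intro!: add_less_le_mono psubset_card_mono card_mono)
      then show ?case using less.IH[OF _ 2(2) _ refl] 2(1) less.prems(2) by auto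
    next
      case (3 y T')
      have "card {j \<in> jobs I. T' < release I j} + card {j \<in> jobs I. work y j T' < volume I j} < n"
        unfolding less.prems(3)
        using 3(3-) fin by (auto intro!: add_le_less_mono psubset_card_mono card_mono)
      then show ?case using less.IH[OF _ 3(2) _ refl] 3(1) less.prems(2) by auto
    qed auto
  qed
  moreover have "follows I R (\<lambda>_ _. 0) {0..<0}"
    by (auto simp: follows_def feasible_def set_integrable_def)
  ultimately show ?thesis by blast
qed

section \<open>Weighted latest arrival processor sharing\<close>

text \<open>Ties are broken by index to obtain a total order; it is reflexive, so a job in
  \<open>S\<close> counts towards its own prefix weight.\<close>

definition precedes :: "(nat \<Rightarrow> real) \<Rightarrow> nat \<Rightarrow> nat \<Rightarrow> bool" where
  "precedes r i j \<longleftrightarrow> r i < r j \<or> r i = r j \<and> i \<le> j"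

definition prefix_weight :: "nat set \<Rightarrow> (nat \<Rightarrow> real) \<Rightarrow> (nat \<Rightarrow> real) \<Rightarrow> nat \<Rightarrow> real" where
  "prefix_weight S r w j = sum w {i \<in> S. precedes r i j}"

lemma exists_last_preceded:
  assumes "finite S" "S \<noteq> {}"
  shows "\<exists>m\<in>S. \<forall>i\<in>S. precedes r i m"
proof -
  define M where "M = Max (r ` S)"
  define L where "L = {i \<in> S. r i = M}"
  have "M \<in> r ` S" using assms by (simp add: M_def)
  then have "finite L" "L \<noteq> {}" using assms by (auto simp: L_def)
  then have "Max L \<in> L" and 1: "\<And>i. i \<in> L \<Longrightarrow> i \<le> Max L" by auto
  then have 2: "Max L \<in> S" "r (Max L) = M" by (auto simp: L_def)
  have "precedes r i (Max L)" if "i \<in> S" for i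
  proof -
    have "r i \<le> M" using assms that by (simp add: M_def)
    then show ?thesis using 1[of i] 2 that by (auto simp: precedes_def L_def)
  qed
  then show ?thesis using 2 by blast
qed

text \<open>In order of arrival, the lower end of each interval is the upper end of the preceding
  one. Removing the last job leaves the other prefix weights unchanged.\<close>

lemma sum_prefix_weight_telescope:
  fixes \<phi> :: "real \<Rightarrow> real"
  assumes "finite S"
  shows "(\<Sum>j\<in>S. \<phi> (prefix_weight S r w j) - \<phi> (prefix_weight S r w j - w j)) =
    \<phi> (sum w S) - \<phi> 0"
  using assms
proof (induction S rule: finite_psubset_induct)
  case (psubset S)
  show ?case
  proof (cases "S = {}")
    case False
    then obtain m where m: "m \<in> S" "\<And>i. i \<in> S \<Longrightarrow> precedes r i m"
      using exists_last_preceded[OF psubset.hyps(1), of r] by blast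
    have *: "prefix_weight S r w j = prefix_weight (S - {m}) r w j" if "j \<in> S - {m}" for j
      unfolding prefix_weight_def using m(2)[of j] that
      by (intro arg_cong[where f = "sum w"]) (auto simp: precedes_def)
    have last: "prefix_weight S r w m = sum w S"
      unfolding prefix_weight_def using m(2) by (intro arg_cong[where f = "sum w"]) auto
    have "(\<Sum>j\<in>S. \<phi> (prefix_weight S r w j) - \<phi> (prefix_weight S r w j - w j)) =
        \<phi> (sum w S) - \<phi> (sum w S - w m) + (\<phi> (sum w (S - {m})) - \<phi> 0)"
      using psubset.IH[of "S - {m}"] m(1) psubset.hyps(1)
      by (subst sum.remove[of S m]) (auto simp: * last)
    also have "sum w (S - {m}) = sum w S - w m"
      using m(1) psubset.hyps(1) by (simp add: sum_diff1)
    finally show ?thesis by simp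
  qed simp
qed

text \<open>Lay out the weights of \<open>S\<close> in order of arrival as consecutive intervals that fill
  \<open>[0, sum w S]\<close>; this is the length of the part of the interval of \<open>j\<close> above \<open>(1 - \<beta>) * sum w S\<close>.\<close>

definition late_weight ::
  "real \<Rightarrow> nat set \<Rightarrow> (nat \<Rightarrow> real) \<Rightarrow> (nat \<Rightarrow> real) \<Rightarrow> nat \<Rightarrow> real" where
  "late_weight \<beta> S r w j = (if j \<in> S then
     max (prefix_weight S r w j) ((1 - \<beta>) * sum w S)
       - max (prefix_weight S r w j - w j) ((1 - \<beta>) * sum w S) else 0)"

lemma late_weight_cong:
  assumes "\<And>i. i \<in> S \<Longrightarrow> r i = r' i \<and> w i = w' i"
  shows "late_weight \<beta> S r w = late_weight \<beta> S r' w'"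
proof
  fix j
  have "prefix_weight S r w j = prefix_weight S r' w' j" if "j \<in> S"
    unfolding prefix_weight_def using assms that by (intro sum.cong) (auto simp: precedes_def)
  moreover have "sum w S = sum w' S" using assms by (intro sum.cong) auto
  ultimately show "late_weight \<beta> S r w j = late_weight \<beta> S r' w' j"
    using assms by (simp add: late_weight_def)
qed

lemma sum_late_weight:
  assumes "finite S" "\<And>j. j \<in> S \<Longrightarrow> 0 \<le> w j" "0 \<le> \<beta>" "\<beta> \<le> 1"
  shows "sum (late_weight \<beta> S r w) S = \<beta> * sum w S"
proof -
  have "0 \<le> sum w S" using assms by (intro sum_nonneg) auto
  then have *: "0 \<le> (1 - \<beta>) * sum w S" "(1 - \<beta>) * sum w S \<le> sum w S"
    using assms mult_right_mono[of "1 - \<beta>" 1 "sum w S"] by auto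
  have "sum (late_weight \<beta> S r w) S =
      max (sum w S) ((1 - \<beta>) * sum w S) - max 0 ((1 - \<beta>) * sum w S)"
    \<comment> \<open>Clipping from below at the threshold is the function \<open>\<phi>\<close> of
      the telescoping sum.\<close>
    using sum_prefix_weight_telescope[OF assms(1), of "\<lambda>y. max y ((1 - \<beta>) * sum w S)" r w]
    by (simp add: late_weight_def)
  then show ?thesis
    by (simp only: max_absorb1[OF *(2)] max_absorb2[OF *(1)]) (simp add: algebra_simps)
qed

text \<open>The third bound is the reason to favour late arrivals: a job that gets a share has
  almost the whole weight in its prefix, hence a price close to the maximal one.\<close>

lemma late_weight_bounds:
  assumes "j \<in> S" "0 \<le> w j"
  shows "0 \<le> late_weight \<beta> S r w j" "late_weight \<beta> S r w j \<le> w j"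
    "late_weight \<beta> S r w j \<noteq> 0 \<Longrightarrow> (1 - \<beta>) * sum w S < prefix_weight S r w j"
  using assms by (auto simp: late_weight_def max_def split: if_splits)

context power_fun
begin

text \<open>Weighted latest arrival processor sharing among the latest fraction \<open>\<epsilon> / 4\<close> of the weight.
  All rates are \<open>0\<close> if the total weight is \<open>0\<close>.\<close>

definition wlaps_rate ::
  "real \<Rightarrow> nat set \<Rightarrow> (nat \<Rightarrow> real) \<Rightarrow> (nat \<Rightarrow> real) \<Rightarrow> nat \<Rightarrow> real" where
  "wlaps_rate \<epsilon> S r w j =
     (1 + \<epsilon>) * pinv (sum w S) * (late_weight (\<epsilon> / 4) S r w j / (\<epsilon> / 4 * sum w S))"

definition wlaps :: "real \<Rightarrow> nonclairvoyant_algorithm" where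
  "wlaps \<epsilon> h = (let S = {j. \<exists>r w. snd h j = Some (r, w, None)} in
     wlaps_rate \<epsilon> S (\<lambda>j. fst (the (snd h j))) (\<lambda>j. fst (snd (the (snd h j)))))"

text \<open>The history enters only through the active set, which turns the circular equation for a
  run into a rule as in \<open>follows\<close>.\<close>

lemma wlaps_history_at:
  "wlaps \<epsilon> (history_at I x t) = wlaps_rate \<epsilon> (active I x t) (release I) (weight I)"
proof -
  have S: "{j. \<exists>r w. snd (history_at I x t) j = Some (r, w, None)} = active I x t"
    by (auto simp: history_at_def active_def not_le split: if_splits)
  have *: "release I i = fst (the (snd (history_at I x t) i)) \<and>
      weight I i = fst (snd (the (snd (history_at I x t) i)))" if "i \<in> active I x t" for i
    using that by (auto simp: history_at_def active_def)
  have "sum (weight I) (active I x t) =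
      sum (\<lambda>i. fst (snd (the (snd (history_at I x t) i)))) (active I x t)"
    using * by (intro sum.cong) auto
  then show ?thesis
    using late_weight_cong[OF *, of "active I x t"]
    by (simp add: wlaps_def S wlaps_rate_def fun_eq_iff)
qed

lemma wlaps_rate_nonneg:
  assumes "0 < \<epsilon>" "\<And>j. j \<in> S \<Longrightarrow> 0 \<le> w j"
  shows "0 \<le> wlaps_rate \<epsilon> S r w j"
proof (cases "j \<in> S")
  case True
  have "0 \<le> sum w S" using assms by (intro sum_nonneg) auto
  then show ?thesis unfolding wlaps_rate_def
    using assms True late_weight_bounds(1)[OF True, of w]
    by (intro mult_nonneg_nonneg divide_nonneg_nonneg pinv_nonneg) auto
qed (simp add: wlaps_rate_def late_weight_def)

lemma wlaps_runs:
  assumes I: "valid_instance I" and \<epsilon>: "0 < \<epsilon>"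
  shows "\<exists>x. runs (wlaps \<epsilon>) I x"
proof -
  \<comment> \<open>\<open>exists_follows\<close> wants nonnegative rates for every set, but weights
    of indices outside the instance are unconstrained; there the rates are set to
    \<open>0\<close>.\<close>
  define R where "R S = (if S \<subseteq> jobs I then wlaps_rate \<epsilon> S (release I) (weight I) else (\<lambda>_. 0))" for S
  have "0 \<le> R S j" for S j
    using I wlaps_rate_nonneg[OF \<epsilon>, of S "weight I"]
    by (auto simp: R_def valid_instance_def subset_iff less_imp_le)
  moreover have "R S j = 0" if "j \<notin> S" for S j
    using that by (auto simp: R_def wlaps_rate_def late_weight_def)
  ultimately obtain x where "follows I R x {0..}"
    using exists_follows[OF I, of R] by auto
  moreover have "active I x t \<subseteq> jobs I" for t by (auto simp: active_def)
  ultimately have "runs (wlaps \<epsilon>) I x"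
    by (auto simp: runs_def follows_def wlaps_history_at R_def)
  then show ?thesis by blast
qed

lemma sum_wlaps_rate:
  assumes S: "finite S" "\<And>j. j \<in> S \<Longrightarrow> 0 \<le> w j" and \<epsilon>: "0 < \<epsilon>" "\<epsilon> \<le> 1" and "sum w S \<noteq> 0"
  shows "sum (wlaps_rate \<epsilon> S r w) S = (1 + \<epsilon>) * pinv (sum w S)"
proof -
  have "sum (wlaps_rate \<epsilon> S r w) S =
      (1 + \<epsilon>) * pinv (sum w S) * (sum (late_weight (\<epsilon>/4) S r w) S / (\<epsilon>/4 * sum w S))"
    by (simp add: wlaps_rate_def sum_distrib_left sum_divide_distrib)
  then show ?thesis using sum_late_weight[OF S, where \<beta> = "\<epsilon>/4" and r = r] assms by simp
qed

end

section \<open>Pointwise estimates along a fixed run\<close>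

locale wlaps_run = power_fun +
  fixes I :: job_instance and \<epsilon> :: real and x :: schedule
  assumes valid: "valid_instance I" and eps: "0 < \<epsilon>" "\<epsilon> \<le> 1" and run: "runs (wlaps \<epsilon>) I x"
begin

lemma feasible_x: "feasible I x"
  using run by (simp add: runs_def)

lemma x_eq: "0 \<le> t \<Longrightarrow> x t = wlaps_rate \<epsilon> (active I x t) (release I) (weight I)"
  using run by (simp add: runs_def wlaps_history_at)

lemma finite_jobs: "finite (jobs I)"
  using valid by (simp add: valid_instance_def)

lemma active_subset: "active I y t \<subseteq> jobs I"
  by (auto simp: active_def)

lemma weight_nonneg: "j \<in> jobs I \<Longrightarrow> 0 \<le> weight I j"
  using valid by (auto simp: valid_instance_def less_imp_le)

text \<open>The shares sum to \<open>1\<close> when the weight is nonzero, and the augmentation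
  cancels the factor \<open>1 + \<epsilon>\<close>. Thus energy and weighted flow coincide, which
  gives the factor \<open>2\<close> in \<open>cost_eq\<close>.\<close>

lemma power_eq_active_weight:
  assumes "0 \<le> t" shows "P (speed I x t / (1 + \<epsilon>)) = active_weight I x t"
proof -
  let ?S = "active I x t"
  have w: "\<And>j. j \<in> ?S \<Longrightarrow> 0 \<le> weight I j" using active_subset weight_nonneg by blast
  have "speed I x t = sum (x t) ?S"
    unfolding speed_def using assms
    by (intro sum.mono_neutral_right finite_jobs active_subset)
      (auto simp: x_eq wlaps_rate_def late_weight_def)
  also have "\<dots> = (if active_weight I x t = 0 then 0 else (1 + \<epsilon>) * pinv (active_weight I x t))"
    using sum_wlaps_rate[OF finite_active[OF valid] w eps] assms
    by (auto simp: active_weight_def x_eq wlaps_rate_def)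
  finally show ?thesis
    using eps active_weight_nonneg[OF valid, of x t] by (auto simp: P_zero P_pinv)
qed

lemma cost_eq:
  "cost (1 + \<epsilon>) P I x = 2 * (\<integral>\<^sup>+t\<in>{0..}. ennreal (active_weight I x t) \<partial>lborel)"
proof -
  have "energy (1 + \<epsilon>) P I x = (\<integral>\<^sup>+t\<in>{0..}. ennreal (active_weight I x t) \<partial>lborel)"
    unfolding energy_def
    by (intro nn_integral_cong) (auto simp: indicator_def power_eq_active_weight)
  then show ?thesis by (simp add: cost_def weighted_flow_eq_nn_integral[OF valid] mult_2)
qed

text \<open>The coefficient of job \<open>j\<close> in the potential. Counting unreleased predecessors as well
  makes it nonincreasing on all of \<open>[0, \<infinity>)\<close> and does not affect its value once \<open>j\<close> is released.\<close>

definition job_coeff :: "nat \<Rightarrow> real \<Rightarrow> real" where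
  "job_coeff j t = (if ennreal t < completion_time I x j
     then price (sum (weight I) {i \<in> jobs I. precedes (release I) i j \<and> ennreal t < completion_time I x i})
     else 0)"

lemma job_coeff_nonneg: "0 \<le> job_coeff j t"
  unfolding job_coeff_def using weight_nonneg by (auto intro!: price_nonneg sum_nonneg)

lemma job_coeff_antimono:
  assumes "s \<le> t" shows "job_coeff j t \<le> job_coeff j s"
proof -
  have st: "ennreal s \<le> ennreal t" using assms by (rule ennreal_leI)
  let ?U = "\<lambda>t. {i \<in> jobs I. precedes (release I) i j \<and> ennreal t < completion_time I x i}"
  have "price (sum (weight I) (?U t)) \<le> price (sum (weight I) (?U s))"
    using finite_jobs weight_nonneg order_le_less_trans[OF st]
    by (intro price_mono sum_mono2 sum_nonneg) auto
  then show ?thesis using job_coeff_nonneg[of j s] order_le_less_trans[OF st]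
    by (auto simp: job_coeff_def)
qed

lemma job_coeff_active:
  assumes "j \<in> active I x t"
  shows "job_coeff j t = price (prefix_weight (active I x t) (release I) (weight I) j)"
proof -
  have "{i \<in> jobs I. precedes (release I) i j \<and> ennreal t < completion_time I x i} =
      {i \<in> active I x t. precedes (release I) i j}"
    using assms by (auto simp: active_def precedes_def)
  then show ?thesis using assms by (simp add: job_coeff_def prefix_weight_def active_def)
qed

lemma prefix_weight_active_bounds:
  "0 \<le> prefix_weight (active I x t) (release I) (weight I) j"
  "prefix_weight (active I x t) (release I) (weight I) j \<le> active_weight I x t"
  unfolding prefix_weight_def active_weight_def
  using finite_active[OF valid] weight_nonneg[OF subsetD[OF active_subset]]
  by (auto intro: sum_nonneg sum_mono2)

text \<open>Bounds the increase caused by the competitor. A job not active for the algorithm is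
  either completed, with coefficient \<open>0\<close>, or unreleased, with rate \<open>0\<close>;
  all other prices are at most that of the total weight.\<close>

lemma sum_job_coeff_mult_le:
  assumes z: "feasible I z"
  shows "(\<Sum>j\<in>jobs I. job_coeff j t * z t j) \<le> active_weight I x t + P (speed I z t)"
proof -
  have "job_coeff j t * z t j \<le> price (active_weight I x t) * z t j" if "j \<in> jobs I" for j
  proof (cases "j \<in> active I x t")
    case True
    then show ?thesis using z feasible_nonneg[OF z] prefix_weight_active_bounds
      by (auto simp: job_coeff_active intro!: mult_right_mono price_mono)
  next
    case False
    then have "job_coeff j t = 0 \<or> z t j = 0"
      using z that by (auto simp: active_def feasible_def job_coeff_def)
    then show ?thesis using feasible_nonneg[OF z] price_nonneg active_weight_nonneg[OF valid]
      by auto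
  qed
  then have "(\<Sum>j\<in>jobs I. job_coeff j t * z t j) \<le> price (active_weight I x t) * speed I z t"
    unfolding speed_def sum_distrib_left by (rule sum_mono)
  also have "\<dots> \<le> active_weight I x t + P (speed I z t)"
    using feasible_nonneg[OF z]
    by (intro price_mult_speed_le active_weight_nonneg[OF valid]) (auto simp: speed_def intro: sum_nonneg)
  finally show ?thesis .
qed

text \<open>Bounds the decrease achieved by the algorithm. \<open>E j\<close> stands for a lag on
  job \<open>j\<close>; shares spent on jobs without lag are wasted, but their weight is charged to
  the competitor.\<close>

lemma sum_job_coeff_mult_ge:
  assumes t: "0 \<le> t" and E: "\<And>j. j \<in> active I x t \<Longrightarrow> \<not> E j \<Longrightarrow> j \<in> active I z t"
  shows "(1 + \<epsilon> / 2) * (active_weight I x t - 4 / \<epsilon> * active_weight I z t)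
    \<le> (\<Sum>j\<in>jobs I. job_coeff j t * (if E j then x t j else 0))"
proof (cases "active_weight I x t = 0")
  case True
  then have "(1 + \<epsilon> / 2) * (active_weight I x t - 4 / \<epsilon> * active_weight I z t) \<le> 0"
    using eps active_weight_nonneg[OF valid, of z t] by (simp add: mult_nonneg_nonpos)
  also have "\<dots> \<le> (\<Sum>j\<in>jobs I. job_coeff j t * (if E j then x t j else 0))"
    using job_coeff_nonneg feasible_nonneg[OF feasible_x] by (intro sum_nonneg) auto
  finally show ?thesis .
next
  case False
  let ?S = "active I x t" and ?W = "active_weight I x t"
  let ?l = "late_weight (\<epsilon> / 4) ?S (release I) (weight I)"
  have W: "0 < ?W" using False active_weight_nonneg[OF valid, of x t] by simp
  have fin: "finite ?S" by (rule finite_active[OF valid])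
  have w: "0 \<le> weight I j" if "j \<in> ?S" for j using that active_subset weight_nonneg by blast
  \<comment> \<open>The product is
    \<open>1 + 3/4 * \<epsilon> - \<epsilon> * \<epsilon> / 4\<close>, and
    \<open>\<epsilon> * \<epsilon> \<le> \<epsilon>\<close>.\<close>
  have e: "1 + \<epsilon> / 2 \<le> (1 - \<epsilon> / 4) * (1 + \<epsilon>)"
  proof -
    have "\<epsilon> * \<epsilon> \<le> \<epsilon>" using eps by (intro mult_left_le) auto
    moreover have "(1 - \<epsilon> / 4) * (1 + \<epsilon>) = 1 + 3 / 4 * \<epsilon> - \<epsilon> * \<epsilon> / 4"
      by (simp add: field_simps)
    ultimately show ?thesis by linarith
  qed
  \<comment> \<open>The factor \<open>4 / \<epsilon>\<close> normalises the late weights, whose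
    total is \<open>\<epsilon> / 4\<close> of the active weight.\<close>
  have job: "(1 + \<epsilon> / 2) * (4 / \<epsilon>) * ?l j \<le> job_coeff j t * x t j" if j: "j \<in> ?S" for j
  proof (cases "?l j = 0")
    case True
    then show ?thesis using job_coeff_nonneg feasible_nonneg[OF feasible_x] by simp
  next
    case False
    let ?p = "prefix_weight ?S (release I) (weight I) j"
    have l: "0 \<le> ?l j" using late_weight_bounds(1)[OF j, where w = "weight I"] w[OF j] by simp
    have p: "(1 - \<epsilon> / 4) * ?W < ?p"
      unfolding active_weight_def
      by (rule late_weight_bounds(3)[where w = "weight I"]) (use j w False in auto)
    have p0: "0 < ?p" by (rule le_less_trans[OF _ p]) (use W eps in simp)
    have "(1 + \<epsilon> / 2) * ?W \<le> (1 - \<epsilon> / 4) * (1 + \<epsilon>) * ?W"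
      using e W by (intro mult_right_mono) auto
    also have "\<dots> \<le> (1 + \<epsilon>) * ?p"
      using mult_left_mono[OF less_imp_le[OF p], of "1 + \<epsilon>"] eps by (simp add: mult_ac)
    also have "\<dots> \<le> (1 + \<epsilon>) * (price ?p * pinv ?W)"
      using eps p0 prefix_weight_active_bounds by (intro mult_left_mono price_mult_pinv_ge) auto
    finally have "(1 + \<epsilon> / 2) * ?W * (?l j / (\<epsilon> / 4 * ?W)) \<le>
        (1 + \<epsilon>) * (price ?p * pinv ?W) * (?l j / (\<epsilon> / 4 * ?W))"
      using l W eps by (intro mult_right_mono) auto
    also have "\<dots> = job_coeff j t * x t j"
      using t by (simp add: job_coeff_active[OF j] x_eq wlaps_rate_def active_weight_def)
    also have "(1 + \<epsilon> / 2) * ?W * (?l j / (\<epsilon> / 4 * ?W)) = (1 + \<epsilon> / 2) * (4 / \<epsilon>) * ?l j"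
      using W eps by (simp add: field_simps)
    finally show ?thesis .
  qed
  have "sum (weight I) {j \<in> ?S. \<not> E j} \<le> active_weight I z t"
    unfolding active_weight_def using E active_subset[of z] weight_nonneg finite_active[OF valid]
    by (intro sum_mono2) auto
  moreover have "sum ?l {j \<in> ?S. \<not> E j} \<le> sum (weight I) {j \<in> ?S. \<not> E j}"
    using w by (intro sum_mono late_weight_bounds) auto
  moreover have "sum ?l {j \<in> ?S. E j} + sum ?l {j \<in> ?S. \<not> E j} = sum ?l ?S"
    using fin by (subst sum.union_disjoint[symmetric]) (auto intro!: arg_cong[where f = "sum ?l"])
  moreover have "sum ?l ?S = \<epsilon> / 4 * ?W"
    unfolding active_weight_def using fin w eps by (intro sum_late_weight) auto
  ultimately have "\<epsilon> / 4 * ?W - active_weight I z t \<le> sum ?l {j \<in> ?S. E j}" by linarith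
  then have "(1 + \<epsilon> / 2) * (4 / \<epsilon>) * (\<epsilon> / 4 * ?W - active_weight I z t) \<le>
      (1 + \<epsilon> / 2) * (4 / \<epsilon>) * sum ?l {j \<in> ?S. E j}"
    using eps by (intro mult_left_mono) auto
  also have "\<dots> = (\<Sum>j\<in>{j \<in> ?S. E j}. (1 + \<epsilon> / 2) * (4 / \<epsilon>) * ?l j)"
    by (rule sum_distrib_left)
  also have "\<dots> \<le> (\<Sum>j\<in>{j \<in> ?S. E j}. job_coeff j t * x t j)"
    using job by (intro sum_mono) auto
  also have "\<dots> = (\<Sum>j\<in>{j \<in> ?S. E j}. job_coeff j t * (if E j then x t j else 0))"
    by (intro sum.cong) auto
  also have "\<dots> \<le> (\<Sum>j\<in>jobs I. job_coeff j t * (if E j then x t j else 0))"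
    using job_coeff_nonneg feasible_nonneg[OF feasible_x] finite_jobs subsetD[OF active_subset]
    by (intro sum_mono2) auto
  finally show ?thesis using eps by (simp add: field_simps)
qed

end

section \<open>Real integrals on bounded intervals and extended integrals on the half-line\<close>

lemma ennreal_integral_eq_nn_integral:
  fixes f :: "real \<Rightarrow> real"
  assumes "set_integrable lborel {a..b} f" "\<And>t. t \<in> {a..b} \<Longrightarrow> 0 \<le> f t"
  shows "ennreal (integral {a..b} f) = (\<integral>\<^sup>+t\<in>{a..b}. ennreal (f t) \<partial>lborel)"
proof -
  have "(\<integral>\<^sup>+t. ennreal (indicator {a..b} t *\<^sub>R f t) \<partial>lborel) =
      ennreal (LBINT t. indicator {a..b} t *\<^sub>R f t)"
    using assms by (intro nn_integral_eq_integral) (auto simp: set_integrable_def indicator_def)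
  also have "(LBINT t. indicator {a..b} t *\<^sub>R f t) = integral {a..b} f"
    using set_borel_integral_eq_integral(2)[OF assms(1)] by (simp add: set_lebesgue_integral_def)
  also have "(\<integral>\<^sup>+t. ennreal (indicator {a..b} t *\<^sub>R f t) \<partial>lborel) =
      (\<integral>\<^sup>+t\<in>{a..b}. ennreal (f t) \<partial>lborel)"
    by (intro nn_integral_cong) (auto simp: indicator_def)
  finally show ?thesis by simp
qed

text \<open>Continuity from below of the measure with density \<open>f\<close> along the intervals
  \<open>{0..real n}\<close>.\<close>

lemma nn_integral_atLeast_le:
  fixes f :: "real \<Rightarrow> ennreal"
  assumes [measurable]: "f \<in> borel_measurable borel"
    and le: "\<And>T. 0 \<le> T \<Longrightarrow> (\<integral>\<^sup>+t\<in>{0..T}. f t \<partial>lborel) \<le> K"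
  shows "(\<integral>\<^sup>+t\<in>{0..}. f t \<partial>lborel) \<le> K"
proof -
  let ?M = "density lborel f"
  have "(\<Union>n::nat. {0..real n}) = {0..}"
    using real_arch_simple by auto
  moreover have "(SUP n::nat. emeasure ?M {0..real n}) = emeasure ?M (\<Union>n::nat. {0..real n})"
    by (intro SUP_emeasure_incseq) (auto simp: incseq_def)
  ultimately have "(\<integral>\<^sup>+t\<in>{0..}. f t \<partial>lborel) = (SUP n::nat. (\<integral>\<^sup>+t\<in>{0..real n}. f t \<partial>lborel))"
    by (simp add: emeasure_density)
  also have "\<dots> \<le> K" using le by (intro SUP_least) auto
  finally show ?thesis .
qed

lemma set_integrable_active_weight:
  assumes "valid_instance I" shows "set_integrable lborel {0..T} (active_weight I y)"
proof -
  have [measurable]: "active_weight I y \<in> borel_measurable borel"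
    by (rule borel_measurable_active_weight[OF assms])
  show ?thesis
  proof (rule set_integrable_bound[where f = "\<lambda>_. sum (weight I) (jobs I)"])
    show "set_integrable lborel {0..T} (\<lambda>_. sum (weight I) (jobs I))"
      by (auto simp: set_integrable_def emeasure_lborel_Icc_eq)
    have "active_weight I y t \<le> sum (weight I) (jobs I)" for t
      unfolding active_weight_def using assms
      by (intro sum_mono2) (auto simp: valid_instance_def active_def less_imp_le)
    then show "AE t in lborel. t \<in> {0..T} \<longrightarrow>
        norm (active_weight I y t) \<le> norm (sum (weight I) (jobs I))"
      using active_weight_nonneg[OF assms]
      by (intro AE_I2) (auto intro: order_trans[OF _ abs_ge_self])
  qed (simp add: set_borel_measurable_def)
qed

section \<open>Amortised analysis\<close>

context wlaps_run
begin

lemma set_integrable_power_speed: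
  assumes z: "feasible I z" and fin: "energy 1 P I z < top"
  shows "set_integrable lborel {0..T} (\<lambda>t. P (speed I z t))"
proof -
  have s0: "0 \<le> speed I z t" for t
    using feasible_nonneg[OF z] by (auto simp: speed_def intro: sum_nonneg)
  have "set_integrable lborel {0..T} (speed I z)"
    unfolding speed_def set_integrable_def scaleR_sum_right
    using z by (intro Bochner_Integration.integrable_sum) (auto simp: feasible_def set_integrable_def)
  then have [measurable]: "(\<lambda>t. indicator {0..T} t *\<^sub>R speed I z t) \<in> borel_measurable borel"
    unfolding set_integrable_def by (auto dest: borel_measurable_integrable)
  have "(\<lambda>t. indicator {0..T} t * P (max 0 (indicator {0..T} t *\<^sub>R speed I z t))) \<in> borel_measurable borel"
    by (intro borel_measurable_times measurable_compose[OF _ P_measurable]) measurable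
  also have "(\<lambda>t. indicator {0..T} t * P (max 0 (indicator {0..T} t *\<^sub>R speed I z t))) =
      (\<lambda>t. indicator {0..T} t *\<^sub>R P (speed I z t))"
    using s0 by (auto simp: fun_eq_iff indicator_def max_def intro: order_antisym)
  finally have meas: "(\<lambda>t. indicator {0..T} t *\<^sub>R P (speed I z t)) \<in> borel_measurable borel" .
  have "(\<integral>\<^sup>+t. ennreal (norm (indicator {0..T} t *\<^sub>R P (speed I z t))) \<partial>lborel) \<le> energy 1 P I z"
    unfolding energy_def using s0 P_nonneg
    by (intro nn_integral_mono) (auto simp: indicator_def)
  then show ?thesis
    unfolding set_integrable_def using meas fin by (intro integrableI_bounded) auto
qed

text \<open>The integral of \<open>?H\<close> plays the role of the final potential: it is
  nonnegative, so adding it to the left side of the integrated pointwise estimate loses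
  nothing.\<close>

lemma amortized_bound:
  assumes z: "feasible I z" and fin: "energy 1 P I z < top" and T: "0 \<le> T"
  shows "\<epsilon> / 2 * integral {0..T} (active_weight I x)
    \<le> integral {0..T} (\<lambda>t. P (speed I z t)) + 6 / \<epsilon> * integral {0..T} (active_weight I z)"
proof -
  define D where "D j t = integral {0..t} (\<lambda>\<tau>. z \<tau> j) - integral {0..t} (\<lambda>\<tau>. x \<tau> j)" for j t
  \<comment> \<open>\<open>h j\<close> dominates the rate of change of \<open>max 0 (D j t)\<close>:
    without a lag the work of the algorithm is ignored, but that of the competitor is kept.\<close>
  define h where "h j t = z t j - (if 0 < D j t then x t j else 0)" for j t
  have zi: "set_integrable lborel {0..u} (\<lambda>t. z t j)" for u j using z by (simp add: feasible_def)
  have xi: "set_integrable lborel {0..u} (\<lambda>t. x t j)" for u j using feasible_x by (simp add: feasible_def)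
  have xr: "(\<lambda>t. if 0 < D j t then x t j else 0) integrable_on {0..u}" for u j
    unfolding D_def
    by (intro integrable_on_if_measurable_condition xi continuous_on_diff
        indefinite_integral_continuous_1 work_eq_integral(1)[OF z] work_eq_integral(1)[OF feasible_x])
  have hi: "h j integrable_on {0..u}" for u j
    unfolding h_def by (intro integrable_diff xr work_eq_integral(1)[OF z])
  have hn: "0 \<le> integral {0..u} (h j)" if "0 \<le> u" for u j
    unfolding h_def
    using integral_ge_integral_restricted_to_excess[OF zi xi feasible_nonneg[OF z]
        feasible_nonneg[OF feasible_x] that, of j j]
    by (simp add: integral_diff[OF work_eq_integral(1)[OF z] xr] flip: D_def)
  have ch: "(\<lambda>t. job_coeff j t * h j t) integrable_on {0..T}"
      "0 \<le> integral {0..T} (\<lambda>t. job_coeff j t * h j t)" for j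
    using integral_antimono_weight_nonneg[OF hi T hn, of "job_coeff j"] job_coeff_antimono job_coeff_nonneg
    by auto
  let ?H = "\<lambda>t. \<Sum>j\<in>jobs I. job_coeff j t * h j t"
  have Hi: "?H integrable_on {0..T}"
    by (intro integrable_sum finite_jobs ch)
  have H0: "0 \<le> integral {0..T} ?H"
    using ch by (subst integral_sum) (auto intro: finite_jobs sum_nonneg)
  note aw = set_borel_integral_eq_integral(1)[OF set_integrable_active_weight[OF valid]]
  note Pi = set_borel_integral_eq_integral(1)[OF set_integrable_power_speed[OF z fin]]
  have pointwise: "\<epsilon> / 2 * active_weight I x t + ?H t \<le>
      P (speed I z t) + 6 / \<epsilon> * active_weight I z t" if t: "t \<in> {0..T}" for t
  proof -
    have t0: "0 \<le> t" using t by simp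
    \<comment> \<open>Without a lag the competitor has done no more work on \<open>j\<close> than
      the algorithm, which has not finished it.\<close>
    have E: "j \<in> active I z t" if "j \<in> active I x t" "\<not> 0 < D j t" for j
      using that unfolding D_def in_active_iff[OF valid z t0] in_active_iff[OF valid feasible_x t0]
        work_eq_integral(2)[OF z] work_eq_integral(2)[OF feasible_x] by auto
    from sum_job_coeff_mult_ge[where E = "\<lambda>j. 0 < D j t", OF t0 E] sum_job_coeff_mult_le[OF z, of t]
    have "?H t \<le> active_weight I x t + P (speed I z t)
        - (1 + \<epsilon> / 2) * (active_weight I x t - 4 / \<epsilon> * active_weight I z t)"
      by (simp add: h_def right_diff_distrib sum_subtractf)
    \<comment> \<open>Since \<open>\<epsilon> \<le> 1\<close>, the first factor is at most
      \<open>3 / 2\<close>, whence the constant \<open>6 / \<epsilon>\<close>.\<close>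
    moreover have "(1 + \<epsilon> / 2) * (4 / \<epsilon> * active_weight I z t) \<le> 3 / 2 * (4 / \<epsilon> * active_weight I z t)"
      using eps active_weight_nonneg[OF valid, of z t] by (intro mult_right_mono) auto
    ultimately show ?thesis by (simp add: algebra_simps)
  qed
  have "\<epsilon> / 2 * integral {0..T} (active_weight I x) + integral {0..T} ?H =
      integral {0..T} (\<lambda>t. \<epsilon> / 2 * active_weight I x t + ?H t)"
    by (subst integral_add) (auto intro!: aw Hi integrable_on_mult_right)
  also have "\<dots> \<le> integral {0..T} (\<lambda>t. P (speed I z t) + 6 / \<epsilon> * active_weight I z t)"
    by (intro integral_le integrable_add integrable_on_mult_right aw Hi Pi pointwise)
  also have "\<dots> = integral {0..T} (\<lambda>t. P (speed I z t)) + 6 / \<epsilon> * integral {0..T} (active_weight I z)"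
    by (subst integral_add[OF Pi integrable_on_mult_right[OF aw]]) simp
  finally show ?thesis using H0 by simp
qed

lemma cost_le:
  assumes z: "feasible I z"
  shows "cost (1 + \<epsilon>) P I x \<le> ennreal (24 / \<epsilon>^2) * cost 1 P I z"
proof (cases "cost 1 P I z = top")
  case True
  then show ?thesis using eps by (simp add: ennreal_mult_top)
next
  case False
  then have fin: "energy 1 P I z < top" by (auto simp: cost_def less_top)
  have s0: "0 \<le> speed I z t" for t
    using feasible_nonneg[OF z] by (auto simp: speed_def intro: sum_nonneg)
  have "(\<integral>\<^sup>+t\<in>{0..T}. ennreal (active_weight I x t) \<partial>lborel) \<le> ennreal (12 / \<epsilon>^2) * cost 1 P I z"
    if T: "0 \<le> T" for T
  proof -
    let ?w = "integral {0..T} (active_weight I x)" and ?v = "integral {0..T} (active_weight I z)"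
    let ?p = "integral {0..T} (\<lambda>t. P (speed I z t))"
    have v0: "0 \<le> ?v" and p0: "0 \<le> ?p"
      using active_weight_nonneg[OF valid] P_nonneg s0
      by (auto intro!: integral_nonneg set_borel_integral_eq_integral(1)
          set_integrable_active_weight[OF valid] set_integrable_power_speed[OF z fin])
    have p: "ennreal ?p \<le> energy 1 P I z"
      unfolding energy_def using P_nonneg s0
      by (subst ennreal_integral_eq_nn_integral[OF set_integrable_power_speed[OF z fin]])
        (auto intro!: nn_integral_mono simp: indicator_def)
    have v: "ennreal ?v \<le> weighted_flow I z"
      unfolding weighted_flow_eq_nn_integral[OF valid] using active_weight_nonneg[OF valid]
      by (subst ennreal_integral_eq_nn_integral[OF set_integrable_active_weight[OF valid]])
        (auto intro!: nn_integral_mono simp: indicator_def)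
    \<comment> \<open>Raising the coefficient of the energy to \<open>6 / \<epsilon>\<close> gives
      both cost terms the same factor; dividing by \<open>\<epsilon> / 2\<close> then yields
      \<open>12 / \<epsilon>^2\<close>.\<close>
    have "1 * ?p \<le> 6 / \<epsilon> * ?p" using p0 eps by (intro mult_right_mono) auto
    then have "\<epsilon> / 2 * ?w \<le> 6 / \<epsilon> * (?v + ?p)"
      using amortized_bound[OF z fin T] by (simp add: distrib_left)
    then have "?w \<le> 12 / \<epsilon>^2 * (?v + ?p)"
      using eps by (simp add: field_simps power2_eq_square)
    then have "ennreal ?w \<le> ennreal (12 / \<epsilon>^2) * (ennreal ?v + ennreal ?p)"
      using v0 p0 by (simp add: ennreal_leI flip: ennreal_mult' ennreal_plus)
    also have "\<dots> \<le> ennreal (12 / \<epsilon>^2) * cost 1 P I z"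
      unfolding cost_def using p v by (intro mult_left_mono add_mono) auto
    finally show ?thesis
      using active_weight_nonneg[OF valid]
      by (simp add: ennreal_integral_eq_nn_integral[OF set_integrable_active_weight[OF valid]])
  qed
  then have "(\<integral>\<^sup>+t\<in>{0..}. ennreal (active_weight I x t) \<partial>lborel) \<le> ennreal (12 / \<epsilon>^2) * cost 1 P I z"
    using borel_measurable_active_weight[OF valid] by (intro nn_integral_atLeast_le) auto
  then have "cost (1 + \<epsilon>) P I x \<le> ennreal 2 * (ennreal (12 / \<epsilon>^2) * cost 1 P I z)"
    unfolding cost_eq by (intro mult_mono) auto
  also have "\<dots> = ennreal (24 / \<epsilon>^2) * cost 1 P I z"
  proof -
    have "ennreal 2 * ennreal (12 / \<epsilon>^2) = ennreal (24 / \<epsilon>^2)"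
      by (subst ennreal_mult[symmetric]) auto
    then show ?thesis by (simp only: mult.assoc[symmetric])
  qed
  finally show ?thesis .
qed

text \<open>The infimum need not be attained; as the constant is positive and finite, it is divided
  out before passing to the infimum.\<close>

lemma cost_le_opt_cost: "cost (1 + \<epsilon>) P I x \<le> ennreal (24 / \<epsilon>^2) * opt_cost P I"
proof -
  let ?c = "ennreal (24 / \<epsilon>^2)"
  have c: "0 < ?c" "?c < top" using eps by auto
  have "cost (1 + \<epsilon>) P I x / ?c \<le> opt_cost P I"
    unfolding opt_cost_def using cost_le c by (auto intro!: INF_greatest divide_le_posI_ennreal)
  then have "?c * (cost (1 + \<epsilon>) P I x / ?c) \<le> ?c * opt_cost P I" by (rule mult_left_mono) simp
  then show ?thesis
    using c by (simp add: ennreal_times_divide mult_divide_eq_ennreal mult.commute[of ?c])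
qed

end

theorem theorem2:
  shows "\<exists>C>0. \<forall>\<epsilon>::real. 0 < \<epsilon> \<and> \<epsilon> \<le> 1 \<longrightarrow>
    (\<forall>P. power_function P \<longrightarrow>
      (\<exists>A :: nonclairvoyant_algorithm. competitive (1 + \<epsilon>) P (C / \<epsilon>^3) A))"
proof (intro exI[of _ 24] conjI allI impI)
  fix \<epsilon> :: real and P
  assume \<epsilon>: "0 < \<epsilon> \<and> \<epsilon> \<le> 1" and "power_function P"
  then interpret power_fun P by unfold_locales
  have "competitive (1 + \<epsilon>) P (24 / \<epsilon>^3) (wlaps \<epsilon>)"
    unfolding competitive_def
  proof (intro allI impI conjI)
    fix I assume I: "valid_instance I"
    then show "\<exists>x. runs (wlaps \<epsilon>) I x" using \<epsilon> by (intro wlaps_runs) auto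
    fix x assume "runs (wlaps \<epsilon>) I x"
    then interpret wlaps_run P I \<epsilon> x using I \<epsilon> by unfold_locales auto
    \<comment> \<open>The quadratic bound is weakened to the cubic one, using
      \<open>\<epsilon> \<le> 1\<close>.\<close>
    have "24 / \<epsilon>^2 \<le> 24 / \<epsilon>^3"
      using \<epsilon> by (intro divide_left_mono power_decreasing mult_pos_pos) auto
    then have "ennreal (24 / \<epsilon>^2) * opt_cost P I \<le> ennreal (24 / \<epsilon>^3) * opt_cost P I"
      by (intro mult_right_mono ennreal_leI) auto
    with cost_le_opt_cost show "cost (1 + \<epsilon>) P I x \<le> ennreal (24 / \<epsilon>^3) * opt_cost P I"
      by (rule order_trans)
  qed
  then show "\<exists>A. competitive (1 + \<epsilon>) P (24 / \<epsilon>^3) A" by blast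
qed simp

end
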